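(* Let $\alpha\ne0$ be a simple root of $f(x)=0$ (so $f'(\alpha)\ne 0$) with $f''(\alpha)\neq0$, and let $q\neq0$ be a real number. (i) If $$0<1+\frac{f'(\alpha)}{f''(\alpha)}\frac{1-q}{\alpha}\le1,$$ then the convexity/concavity of the curve $y=g(x)$ in a neighborhood of $x=\alpha^q$ (where $g(\alpha^q)=0$) is the same as that of $y=f(x)$ in a neighborhood of $x=\alpha$. (ii) If $$-1\le1+\frac{f'(\alpha)}{f''(\alpha)}\frac{1-q}{\alpha}<0,$$ then the convexity/concavity of $y=g(x)$ in a neighborhood of $x=\alpha^q$ is opposite to that of $y=f(x)$ in a neighborhood of $x=\alpha$.
   Context: $f$ is a real function of a real variable, $C^2$ near $\alpha$, and $g(t)=f(t^{1/q})$, so $g(x^q)=f(x)$. Real powers occurring are assumed to be defined as real numbers (e.g. positive base), and $t\mapsto t^{1/q}$ is the inverse of $x\mapsto x^q$ near $\alpha$. "Same" means both functions are convex, or both concave, on suitable neighborhoods of the respective points; "opposite" means one is convex and the other concave there (in the strict sense, determined by the sign of the second derivative). *)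

theory Defs
  imports "HOL-Analysis.Analysis"
begin

text \<open>
  The library's \<open>powr\<close> satisfies \<open>(-x) powr q = x powr q\<close>, so it is the real power
  only for positive bases. For \<open>x < 0\<close> the power \<open>x\<^sup>q\<close> is a real number when
  \<open>q = m / n\<close> with integers \<open>m\<close> and odd \<open>n\<close>, namely the \<open>m\<close>-th power of the real \<open>n\<close>-th root
  of \<open>x\<close> (see \<open>rpow_fraction\<close> below); its sign is that of \<open>(-1)^m\<close>.
  Outside \<open>rpow_defined\<close>, \<open>rpow\<close> has the dummy value 0.
\<close>

definition rpow_defined :: "real \<Rightarrow> real \<Rightarrow> bool" where
  "rpow_defined x q \<longleftrightarrow>
     x > 0 \<or> (x = 0 \<and> q > 0) \<or>
     (x < 0 \<and> (\<exists>m n :: int. odd n \<and> q = of_int m / of_int n))"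

definition rpow :: "real \<Rightarrow> real \<Rightarrow> real" where
  "rpow x q =
     (if x > 0 then x powr q
      else if x < 0 \<and> (\<exists>m n :: int. even m \<and> odd n \<and> q = of_int m / of_int n) then (- x) powr q
      else if x < 0 \<and> (\<exists>m n :: int. odd m \<and> odd n \<and> q = of_int m / of_int n) then - ((- x) powr q)
      else 0)"

lemma odd_fraction_parity:
  fixes m n m' n' :: int
  assumes "odd n" "odd n'" "(of_int m :: real) / of_int n = of_int m' / of_int n'"
  shows "even m \<longleftrightarrow> even m'"
proof -
  have "n \<noteq> 0" "n' \<noteq> 0" using assms(1,2) by auto
  then have "(of_int (m * n') :: real) = of_int (m' * n)"
    using assms(3) by (simp add: field_simps)
  then have "m * n' = m' * n" by linarith
  then show ?thesis using assms(1,2) by (metis even_mult_iff)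
qed

lemma rpow_fraction:
  fixes x :: real and m :: int and n :: nat
  assumes "x \<noteq> 0" "odd n"
  shows "rpow x (of_int m / of_nat n) = root n x powi m"
proof -
  have n: "n > 0" using assms(2) by (simp add: odd_pos)
  have pos: "y powr (of_int m / of_nat n) = root n y powi m" if "y > 0" for y :: real
  proof -
    have "root n y powi m = root n y powr of_int m"
      using that n by (simp add: powr_real_of_int')
    also have "\<dots> = y powr (of_int m / of_nat n)"
      using that n by (simp add: root_powr_inverse powr_powr)
    finally show ?thesis by simp
  qed
  show ?thesis
  proof (cases "x > 0")
    case True
    then show ?thesis by (simp add: rpow_def pos)
  next
    case False
    then have x: "x < 0" using assms(1) by simp
    define q :: real where "q = of_int m / of_int (int n)"
    have on: "odd (int n)" using assms(2) by simp
    have par: "even m' \<longleftrightarrow> even m" if "odd n'" "q = of_int m' / of_int n'" for m' n' :: int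
      using odd_fraction_parity[OF that(1) on] that(2) unfolding q_def by metis
    have ex1: "(\<exists>m' n' :: int. even m' \<and> odd n' \<and> q = of_int m' / of_int n') \<longleftrightarrow> even m"
      using par on q_def by blast
    have ex2: "(\<exists>m' n' :: int. odd m' \<and> odd n' \<and> q = of_int m' / of_int n') \<longleftrightarrow> odd m"
      using par on q_def by blast
    have q: "of_int m / of_nat n = q" by (simp add: q_def)
    have r: "root n x = - root n (- x)" by (simp add: real_root_minus)
    show ?thesis
    proof (cases "even m")
      case True
      then have "root n x powi m = root n (- x) powi m"
        unfolding r by (simp add: power_int_minus_left)
      then show ?thesis using x True pos[of "- x"]
        unfolding rpow_def q ex1 ex2 by simp
    next
      case False
      then have "root n x powi m = - (root n (- x) powi m)"
        unfolding r by (simp add: power_int_minus_left)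
      then show ?thesis using x False pos[of "- x"]
        unfolding rpow_def q ex1 ex2 by simp
    qed
  qed
qed

text \<open>
  \<open>t \<mapsto> t\<^sup>1\<^sup>/\<^sup>q\<close> inverts \<open>x \<mapsto> x\<^sup>q\<close> near \<open>a\<close>, all powers being real numbers.
  This holds for every \<open>a > 0\<close>, \<open>q \<noteq> 0\<close>; for \<open>a < 0\<close> it forces \<open>q\<close> to be
  a quotient of odd integers.
\<close>

definition rpow_invertible_near :: "real \<Rightarrow> real \<Rightarrow> bool" where
  "rpow_invertible_near a q \<longleftrightarrow>
     (\<forall>\<^sub>F x in nhds a. rpow_defined x q \<and> rpow_defined (rpow x q) (1 / q)
        \<and> rpow (rpow x q) (1 / q) = x)"

lemma rpow_invertible_near_pos:
  assumes "a > 0" "q \<noteq> 0"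
  shows "rpow_invertible_near a q"
proof -
  have "\<forall>\<^sub>F x in nhds a. x > 0"
    using assms(1) eventually_nhds_in_open[of "{0<..}" a] by auto
  then show ?thesis
    unfolding rpow_invertible_near_def
  proof eventually_elim
    case (elim x)
    then have "x powr q > 0" "(x powr q) powr (1 / q) = x"
      using assms(2) by (simp_all add: powr_powr)
    then show ?case using elim by (simp add: rpow_def rpow_defined_def)
  qed
qed

definition C2_near :: "(real \<Rightarrow> real) \<Rightarrow> real \<Rightarrow> bool" where
  "C2_near f a \<longleftrightarrow>
     (\<exists>e>0. (\<forall>x\<in>ball a e. f differentiable at x \<and> deriv f differentiable at x)
        \<and> continuous_on (ball a e) (deriv (deriv f)))"

text \<open>
  Convexity and concavity in the strict sense: besides the library's (non-strict) notions,
  the second derivative exists and has the corresponding strict sign.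
\<close>

definition convex_near :: "(real \<Rightarrow> real) \<Rightarrow> real \<Rightarrow> bool" where
  "convex_near f a \<longleftrightarrow>
     (\<exists>e>0. convex_on (ball a e) f \<and>
        (\<forall>x\<in>ball a e. f differentiable at x \<and> deriv f differentiable at x
           \<and> deriv (deriv f) x > 0))"

definition concave_near :: "(real \<Rightarrow> real) \<Rightarrow> real \<Rightarrow> bool" where
  "concave_near f a \<longleftrightarrow>
     (\<exists>e>0. concave_on (ball a e) f \<and>
        (\<forall>x\<in>ball a e. f differentiable at x \<and> deriv f differentiable at x
           \<and> deriv (deriv f) x < 0))"

definition same_convexity :: "(real \<Rightarrow> real) \<Rightarrow> real \<Rightarrow> (real \<Rightarrow> real) \<Rightarrow> real \<Rightarrow> bool" where
  "same_convexity g b f a \<longleftrightarrow>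
     (convex_near g b \<and> convex_near f a) \<or> (concave_near g b \<and> concave_near f a)"

definition opposite_convexity :: "(real \<Rightarrow> real) \<Rightarrow> real \<Rightarrow> (real \<Rightarrow> real) \<Rightarrow> real \<Rightarrow> bool" where
  "opposite_convexity g b f a \<longleftrightarrow>
     (convex_near g b \<and> concave_near f a) \<or> (concave_near g b \<and> convex_near f a)"

end

(* Write g = f o h with h(t) = t^(1/q). The chain rule at t = alpha^q gives
   g'' = h'^2 f''(alpha) (1 + f'(alpha) / f''(alpha) * (1 - q) / alpha),
   so the sign of the last factor decides whether g'' and f'' have the same sign;
   strict convexity or concavity near the point follows by continuity of the second derivatives. *)
theory Submission
  imports Defs
begin

section \<open>From the sign of f'' at a point to strict convexity or concavity nearby\<close>

text \<open>Continuity of f'' makes the set where it is positive open, so positivity at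
  \<open>a\<close> spreads to a ball, and there the second derivative test applies. Used for both
  \<open>f\<close> and \<open>g\<close>.\<close>

lemma C2_near_convex_near:
  assumes "C2_near f a" and "deriv (deriv f) a > 0"
  shows "convex_near f a"
proof -
  obtain e where "e > 0"
    and diff: "\<And>x. x \<in> ball a e \<Longrightarrow> f differentiable at x \<and> deriv f differentiable at x"
    and cont: "continuous_on (ball a e) (deriv (deriv f))"
    using assms(1) unfolding C2_near_def by blast
  have "open (ball a e \<inter> deriv (deriv f) -` {0<..})"
    using cont by (intro continuous_open_preimage) auto
  then obtain d where "d > 0" and d: "ball a d \<subseteq> ball a e \<inter> deriv (deriv f) -` {0<..}"
    by (rule openE[where x = a]) (use assms(2) \<open>e > 0\<close> in simp, blast)
  have D: "f differentiable at x \<and> deriv f differentiable at x \<and> deriv (deriv f) x > 0"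
    if "x \<in> ball a d" for x
    using that d diff by auto
  have "convex_on (ball a d) f"
    by (rule f''_ge0_imp_convex[where f' = "deriv f" and f'' = "deriv (deriv f)"])
      (use D in \<open>auto simp: DERIV_deriv_iff_real_differentiable intro: less_imp_le\<close>)
  with D \<open>d > 0\<close> show ?thesis unfolding convex_near_def by blast
qed

lemma C2_near_concave_near:
  assumes "C2_near f a" and "deriv (deriv f) a < 0"
  shows "concave_near f a"
proof -
  obtain e where "e > 0"
    and diff: "\<And>x. x \<in> ball a e \<Longrightarrow> f differentiable at x \<and> deriv f differentiable at x"
    and cont: "continuous_on (ball a e) (deriv (deriv f))"
    using assms(1) unfolding C2_near_def by blast
  have "open (ball a e \<inter> deriv (deriv f) -` {..<0})"
    using cont by (intro continuous_open_preimage) auto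
  then obtain d where "d > 0" and d: "ball a d \<subseteq> ball a e \<inter> deriv (deriv f) -` {..<0}"
    by (rule openE[where x = a]) (use assms(2) \<open>e > 0\<close> in simp, blast)
  have D: "f differentiable at x \<and> deriv f differentiable at x \<and> deriv (deriv f) x < 0"
    if "x \<in> ball a d" for x
    using that d diff by auto
  have "concave_on (ball a d) f"
    by (rule f''_le0_imp_concave[where f' = "deriv f" and f'' = "deriv (deriv f)"])
      (use D in \<open>auto simp: DERIV_deriv_iff_real_differentiable intro: less_imp_le\<close>)
  with D \<open>d > 0\<close> show ?thesis unfolding concave_near_def by blast
qed

section \<open>Second derivative of a composition\<close>

text \<open>The chain rule applied twice, with the product rule in between. Since derivatives are
  local, it is enough that \<open>g\<close> agrees with the composition on an open set
  \<open>S\<close>; in the application this is a half-line on which the power has a closed formula.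
  The regularity of \<open>g\<close> is part of the conclusion because the sign of g'' has to be
  carried from \<open>b\<close> to a neighborhood.\<close>

lemma second_deriv_compose:
  fixes f g h h' h'' :: "real \<Rightarrow> real"
  assumes f: "C2_near f (h b)"
    and S: "open S" "b \<in> S"
    and g: "\<And>t. t \<in> S \<Longrightarrow> g t = f (h t)"
    and h: "\<And>t. t \<in> S \<Longrightarrow> (h has_real_derivative h' t) (at t)"
    and h': "\<And>t. t \<in> S \<Longrightarrow> (h' has_real_derivative h'' t) (at t)"
    and h'': "continuous_on S h''"
  shows "C2_near g b"
    and "deriv (deriv g) b = deriv (deriv f) (h b) * (h' b)\<^sup>2 + deriv f (h b) * h'' b"
proof -
  obtain e where "e > 0"
    and diff: "\<And>x. x \<in> ball (h b) e \<Longrightarrow> f differentiable at x \<and> deriv f differentiable at x"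
    and cont: "continuous_on (ball (h b) e) (deriv (deriv f))"
    using f unfolding C2_near_def by blast
  \<comment> \<open>On \<open>T\<close> both inputs are available: the formula for \<open>g\<close>,
    and the differentiability of \<open>f\<close> at \<open>h t\<close>.\<close>
  define T where "T = S \<inter> h -` ball (h b) e"
  have ch: "continuous_on S h"
    by (rule DERIV_continuous_on) (rule has_field_derivative_at_within[OF h])
  have ch': "continuous_on S h'"
    by (rule DERIV_continuous_on) (rule has_field_derivative_at_within[OF h'])
  have T: "open T" "b \<in> T"
    unfolding T_def using S ch \<open>e > 0\<close> by (auto intro: continuous_open_preimage)
  have g1: "(g has_real_derivative deriv f (h t) * h' t) (at t)" if "t \<in> T" for t
  proof (rule has_field_derivative_transform_within_open[OF _ T(1) that])
    show "((\<lambda>t. f (h t)) has_real_derivative deriv f (h t) * h' t) (at t)"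
      using that diff h by (intro DERIV_chain2) (auto simp: T_def DERIV_deriv_iff_real_differentiable)
  qed (auto simp: T_def g)
  define g2 where "g2 t = deriv (deriv f) (h t) * (h' t)\<^sup>2 + deriv f (h t) * h'' t" for t
  have g2: "(deriv g has_real_derivative g2 t) (at t)" if "t \<in> T" for t
  \<comment> \<open>By \<open>g1\<close>, \<open>deriv g\<close> equals f'(h) h' on all of the open
    set \<open>T\<close>, so differentiating that product gives the derivative of
    \<open>deriv g\<close>.\<close>
  proof (rule has_field_derivative_transform_within_open[OF _ T(1) that])
    have "((\<lambda>t. deriv f (h t)) has_real_derivative deriv (deriv f) (h t) * h' t) (at t)"
      using that diff h by (intro DERIV_chain2) (auto simp: T_def DERIV_deriv_iff_real_differentiable)
    from DERIV_mult[OF this h'] that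
    show "((\<lambda>t. deriv f (h t) * h' t) has_real_derivative g2 t) (at t)"
      by (simp add: T_def g2_def power2_eq_square algebra_simps)
  qed (simp add: DERIV_imp_deriv[OF g1])
  have dg2: "deriv (deriv g) t = g2 t" if "t \<in> T" for t
    using g2[OF that] by (rule DERIV_imp_deriv)
  have "continuous_on (ball (h b) e) (deriv f)"
    using diff by (intro differentiable_imp_continuous_on)
      (auto simp: differentiable_on_def intro: differentiable_at_withinI)
  then have "continuous_on T (\<lambda>t. deriv f (h t))"
    by (rule continuous_on_compose2) (auto simp: T_def intro: continuous_on_subset[OF ch])
  moreover have "continuous_on T (\<lambda>t. deriv (deriv f) (h t))"
    by (rule continuous_on_compose2[OF cont]) (auto simp: T_def intro: continuous_on_subset[OF ch])
  moreover have "continuous_on T h'" "continuous_on T h''"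
    using ch' h'' continuous_on_subset unfolding T_def by blast+
  ultimately have "continuous_on T g2"
    unfolding g2_def by (intro continuous_on_add continuous_on_mult continuous_on_power)
  then have cont2: "continuous_on T (deriv (deriv g))"
    using continuous_on_cong[OF refl, of T "deriv (deriv g)" g2] dg2 by blast
  obtain d where "d > 0" "ball b d \<subseteq> T"
    using openE[OF T] .
  then have "g differentiable at t \<and> deriv g differentiable at t" if "t \<in> ball b d" for t
    using g1[of t] g2[of t] that unfolding real_differentiable_def by blast
  then show "C2_near g b"
    unfolding C2_near_def
    using \<open>d > 0\<close> continuous_on_subset[OF cont2 \<open>ball b d \<subseteq> T\<close>] by blast
  show "deriv (deriv g) b = deriv (deriv f) (h b) * (h' b)\<^sup>2 + deriv f (h b) * h'' b"
    using dg2[OF T(2)] by (simp add: g2_def)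
qed

section \<open>Real powers on the half-line containing \<open>a\<close>\<close>

text \<open>The parity of the numerator is the same in all representations of \<open>q\<close> with
  odd denominator, so one odd numerator excludes the even branch of \<open>rpow\<close>.\<close>

lemma rpow_odd_fraction:
  fixes x q :: real and m n :: int
  assumes "x < 0" "odd m" "odd n" "q = of_int m / of_int n"
  shows "rpow x q = - ((- x) powr q)"
proof -
  have "\<not> (\<exists>m' n' :: int. even m' \<and> odd n' \<and> q = of_int m' / of_int n')"
    using odd_fraction_parity assms(2-4) by metis
  then show ?thesis using assms unfolding rpow_def by auto
qed

text \<open>With an even numerator the power of a negative \<open>a\<close> would be positive, and a
  further power of it would stay positive, so it could not return to \<open>a\<close>.\<close>

lemma rpow_invertible_near_neg:
  assumes "a < 0" "rpow_invertible_near a q"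
  obtains m n :: int where "odd m" "odd n" "q = of_int m / of_int n"
proof -
  \<comment> \<open>A property that holds eventually in \<open>nhds a\<close> holds at
    \<open>a\<close> itself.\<close>
  have *: "rpow_defined a q" "rpow (rpow a q) (1 / q) = a"
    using eventually_nhds_x_imp_x[OF assms(2)[unfolded rpow_invertible_near_def]] by auto
  from *(1) assms(1) obtain m n :: int where mn: "odd n" "q = of_int m / of_int n"
    unfolding rpow_defined_def by auto
  have "odd m"
  proof
    assume "even m"
    then have "rpow a q = (- a) powr q"
      using assms(1) mn unfolding rpow_def by auto
    then have "rpow a q > 0" using assms(1) by simp
    then have "rpow (rpow a q) (1 / q) > 0" by (simp add: rpow_def)
    then show False using *(2) assms(1) by simp
  qed
  with mn that show thesis by blast
qed

text \<open>Treating both signs of \<open>a\<close> at once: by oddness of the power, \<open>x\<^sup>q = s (s x)\<^sup>q\<close> with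
  \<open>s = sgn a\<close>.\<close>

lemma rpow_sgn:
  assumes "a \<noteq> 0" "rpow_invertible_near a q" "sgn a * x > 0"
  shows "rpow x q = sgn a * (sgn a * x) powr q"
    and "rpow_defined x (1 / q)"
    and "rpow x (1 / q) = sgn a * (sgn a * x) powr (1 / q)"
proof -
  have "rpow x q = sgn a * (sgn a * x) powr q \<and> rpow_defined x (1 / q) \<and>
    rpow x (1 / q) = sgn a * (sgn a * x) powr (1 / q)"
  proof (cases "a > 0")
    case True
    then show ?thesis using assms(3) by (simp add: rpow_def rpow_defined_def)
  next
    case False
    then have "a < 0" using assms(1) by simp
    then have x: "x < 0" and s: "sgn a = - 1" using assms(3) by auto
    obtain m n :: int where mn: "odd m" "odd n" "q = of_int m / of_int n"
      using rpow_invertible_near_neg[OF \<open>a < 0\<close> assms(2)] .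
    \<comment> \<open>Since \<open>m\<close> is odd too, 1/q is again a quotient of odd integers, so
      the same sign rule governs the inverse power.\<close>
    then have inv: "1 / q = of_int n / of_int m" by simp
    have "rpow_defined x (1 / q)"
      unfolding rpow_defined_def using x mn(1) inv by blast
    then show ?thesis
      using rpow_odd_fraction[OF x mn] rpow_odd_fraction[OF x mn(2,1) inv] s by simp
  qed
  then show "rpow x q = sgn a * (sgn a * x) powr q" "rpow_defined x (1 / q)"
    "rpow x (1 / q) = sgn a * (sgn a * x) powr (1 / q)" by auto
qed

section \<open>The substitution by the inverse power\<close>

text \<open>The inverse power h satisfies h'' = h'^2 (1 - q) / h, because p (p - 1) / p^2 = 1 - q
  for p = 1/q. Hence h'^2 is a common factor in g'' = f''(h) h'^2 + f'(h) h'', and what remains at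
  \<open>a\<close> is the bracket in the last claim.\<close>

lemma second_deriv_rpow_substitution:
  fixes f g :: "real \<Rightarrow> real" and a q :: real
  assumes "a \<noteq> 0" "q \<noteq> 0" "C2_near f a" "rpow_invertible_near a q"
    and g: "\<And>t. rpow_defined t (1 / q) \<Longrightarrow> g t = f (rpow t (1 / q))"
  shows "g (rpow a q) = f a"
    and "C2_near g (rpow a q)"
    and "deriv (deriv g) (rpow a q) =
      (\<bar>a\<bar> powr (1 - q) / q)\<^sup>2 * (deriv (deriv f) a + deriv f a * ((1 - q) / a))"
proof -
  define s where "s = sgn a"
  define p where "p = 1 / q"
  define b where "b = rpow a q"
  \<comment> \<open>The open half-line on the side of zero where \<open>a\<close> lies; it also
    contains \<open>b\<close>.\<close>
  define S where "S = {t. s * t > 0}"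
  \<comment> \<open>Each differentiation of the inner function \<open>s * t\<close> produces a
    factor \<open>s\<close>. In \<open>h'\<close> it cancels against the outer \<open>s\<close>, as
    \<open>s * s = 1\<close>; in \<open>h''\<close> one factor is left.\<close>
  define h h' h'' where "h t = s * (s * t) powr p"
    and "h' t = p * (s * t) powr (p - 1)"
    and "h'' t = s * (p * (p - 1) * (s * t) powr (p - 2))" for t
  have ss: "s * s = 1" and sa: "s * a = \<bar>a\<bar>" using assms(1) by (auto simp: s_def sgn_if)
  have b: "b = s * \<bar>a\<bar> powr q"
    using rpow_sgn(1)[OF assms(1,4), of a] assms(1) sa by (simp add: b_def s_def)
  then have sb: "s * b = \<bar>a\<bar> powr q" using ss by (simp add: mult.assoc[symmetric])
  have "open S" unfolding S_def by (intro open_Collect_less continuous_intros)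
  have "b \<in> S" using sb assms(1) by (simp add: S_def)
  have hb: "h b = a"
  proof -
    have "h b = s * \<bar>a\<bar>" using assms(1,2) by (simp add: h_def sb powr_powr p_def)
    also have "\<dots> = a" by (simp add: s_def sgn_mult_abs)
    finally show ?thesis .
  qed
  have gh: "g t = f (h t)" if "t \<in> S" for t
    using rpow_sgn[OF assms(1,4), of t] g that by (simp add: S_def s_def h_def p_def)
  show "g (rpow a q) = f a"
    using gh[OF \<open>b \<in> S\<close>] hb by (simp add: b_def)
  have pw: "((\<lambda>t. (s * t) powr r) has_real_derivative r * (s * t) powr (r - 1) * s) (at t)"
    if "t \<in> S" for r t
    using that by (auto intro!: derivative_eq_intros simp: S_def)
  have dh: "(h has_real_derivative h' t) (at t)" if "t \<in> S" for t
  proof -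
    have "s * (p * (s * t) powr (p - 1) * s) = s * s * h' t"
      by (simp add: h'_def)
    with DERIV_cmult[OF pw[OF that], of s p] ss show ?thesis unfolding h_def by simp
  qed
  have dh': "(h' has_real_derivative h'' t) (at t)" if "t \<in> S" for t
    using DERIV_cmult[OF pw[OF that], of p "p - 1"] unfolding h'_def h''_def
    by (simp add: mult_ac)
  have ch'': "continuous_on S h''"
    unfolding h''_def by (intro continuous_intros) (auto simp: S_def)
  have f: "C2_near f (h b)" using assms(3) hb by simp
  note comp = second_deriv_compose[OF f \<open>open S\<close> \<open>b \<in> S\<close> gh dh dh' ch'']
  show "C2_near g (rpow a q)" using comp(1) by (simp add: b_def)
  define c where "c = \<bar>a\<bar> powr (1 - q) / q"
  have h'b: "h' b = c"
  proof -
    have "q * (p - 1) = 1 - q" using assms(2) by (simp add: p_def right_diff_distrib)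
    then show ?thesis by (simp add: h'_def sb powr_powr c_def p_def)
  qed
  have "h'' b = s * (p * (p - 1) * \<bar>a\<bar> powr (1 - 2 * q))"
  proof -
    have "q * (p - 2) = 1 - 2 * q" using assms(2) by (simp add: p_def right_diff_distrib)
    then show ?thesis by (simp add: h''_def sb powr_powr)
  qed
  \<comment> \<open>Writing the exponent as 1 - 2q = 2(1 - q) - 1 makes the square of h'(b)
    appear.\<close>
  also have "\<bar>a\<bar> powr (1 - 2 * q) = (\<bar>a\<bar> powr (1 - q))\<^sup>2 / \<bar>a\<bar>"
  proof -
    have "\<bar>a\<bar> powr (1 - 2 * q) * \<bar>a\<bar> powr 1 = \<bar>a\<bar> powr (1 - q) * \<bar>a\<bar> powr (1 - q)"
      unfolding powr_add[symmetric] by simp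
    then show ?thesis using assms(1) by (simp add: power2_eq_square field_simps)
  qed
  \<comment> \<open>Here p (p - 1) = (1 - q) / q^2, and the factor 1/q^2 is absorbed into
    \<open>c\<^sup>2\<close>.\<close>
  also have "s * (p * (p - 1) * ((\<bar>a\<bar> powr (1 - q))\<^sup>2 / \<bar>a\<bar>)) = c\<^sup>2 * ((1 - q) * (s / \<bar>a\<bar>))"
    using assms(2) by (simp add: c_def p_def power2_eq_square field_simps)
  also have "s / \<bar>a\<bar> = 1 / a"
    using assms(1) by (simp add: s_def sgn_if)
  finally have h''b: "h'' b = c\<^sup>2 * ((1 - q) / a)" by simp
  show "deriv (deriv g) (rpow a q) =
      (\<bar>a\<bar> powr (1 - q) / q)\<^sup>2 * (deriv (deriv f) a + deriv f a * ((1 - q) / a))"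
    using comp(2) unfolding hb h'b h''b unfolding b_def c_def by (simp add: distrib_left mult_ac)
qed

section \<open>Comparing the signs of f'' and g''\<close>

text \<open>Stating the sign condition through the product covers the convex and the concave case
  together.\<close>

lemma same_convexityI:
  assumes "C2_near f a" "C2_near g b" "deriv (deriv g) b * deriv (deriv f) a > 0"
  shows "same_convexity g b f a"
  using assms(3) C2_near_convex_near[OF assms(1)] C2_near_convex_near[OF assms(2)]
    C2_near_concave_near[OF assms(1)] C2_near_concave_near[OF assms(2)]
  unfolding same_convexity_def zero_less_mult_iff by blast

lemma opposite_convexityI:
  assumes "C2_near f a" "C2_near g b" "deriv (deriv g) b * deriv (deriv f) a < 0"
  shows "opposite_convexity g b f a"
  using assms(3) C2_near_convex_near[OF assms(1)] C2_near_convex_near[OF assms(2)]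
    C2_near_concave_near[OF assms(1)] C2_near_concave_near[OF assms(2)]
  unfolding opposite_convexity_def mult_less_0_iff by blast

theorem theorem4p4:
  fixes f g :: "real \<Rightarrow> real" and \<alpha> q :: real
  assumes "\<alpha> \<noteq> 0" and "q \<noteq> 0"
    and "C2_near f \<alpha>"
    and "f \<alpha> = 0" and "deriv f \<alpha> \<noteq> 0" and "deriv (deriv f) \<alpha> \<noteq> 0"
    and "rpow_invertible_near \<alpha> q"
    and "\<And>t. rpow_defined t (1 / q) \<Longrightarrow> g t = f (rpow t (1 / q))"
  shows "(0 < 1 + deriv f \<alpha> / deriv (deriv f) \<alpha> * ((1 - q) / \<alpha>) \<and>
          1 + deriv f \<alpha> / deriv (deriv f) \<alpha> * ((1 - q) / \<alpha>) \<le> 1 \<longrightarrow>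
            g (rpow \<alpha> q) = 0 \<and> same_convexity g (rpow \<alpha> q) f \<alpha>) \<and>
         (- 1 \<le> 1 + deriv f \<alpha> / deriv (deriv f) \<alpha> * ((1 - q) / \<alpha>) \<and>
          1 + deriv f \<alpha> / deriv (deriv f) \<alpha> * ((1 - q) / \<alpha>) < 0 \<longrightarrow>
            g (rpow \<alpha> q) = 0 \<and> opposite_convexity g (rpow \<alpha> q) f \<alpha>)"
proof -
  define K where "K = 1 + deriv f \<alpha> / deriv (deriv f) \<alpha> * ((1 - q) / \<alpha>)"
  \<comment> \<open>Multiplying g'' by f'' turns the comparison of signs into the sign of
    \<open>c * K\<close>, where \<open>c\<close> is the square of h' f'' and is positive because
    \<alpha>, \<open>q\<close> and f''(\<alpha>) are nonzero.\<close>
  define c where "c = (\<bar>\<alpha>\<bar> powr (1 - q) / q * deriv (deriv f) \<alpha>)\<^sup>2"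
  note g = second_deriv_rpow_substitution[OF assms(1-3,7,8)]
  have "c > 0" using assms(1,2,6) by (simp add: c_def)
  have "deriv (deriv f) \<alpha> + deriv f \<alpha> * ((1 - q) / \<alpha>) = deriv (deriv f) \<alpha> * K"
    using assms(6) by (simp add: K_def distrib_left)
  then have "deriv (deriv g) (rpow \<alpha> q) * deriv (deriv f) \<alpha> = c * K"
    using g(3) by (simp add: c_def power2_eq_square)
  then have "K > 0 \<Longrightarrow> same_convexity g (rpow \<alpha> q) f \<alpha>"
    and "K < 0 \<Longrightarrow> opposite_convexity g (rpow \<alpha> q) f \<alpha>"
    using \<open>c > 0\<close> same_convexityI[OF assms(3) g(2)] opposite_convexityI[OF assms(3) g(2)]
    by (simp_all add: mult_less_0_iff)
  then show ?thesis
    using g(1) assms(4) unfolding K_def[symmetric] by simp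
qed

end
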